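(* Let $L$ be a Lagrangian, $f$ a constraint function and $H$ the associated Hamiltonian. Let $\Phi_i=\{\phi_i(s,\cdot)\}_{s\in\mathbb{R}}$, $i=1,2,3$, be three one parameter groups of diffeomorphisms of $\mathbb{R}^d$, $\mathbb{R}^m$ and $\mathbb{R}^d$ respectively, and assume that $H$ is ${}_{\mathrm{c}}\Delta^\alpha_-$-invariant under the action of $(\Phi_i)_{i=1,2,3}$. Then, for any solution $(Q,U,P)\in(\mathbb{R}^d)^{N+1}\times(\mathbb{R}^m)^{N+1}\times(\mathbb{R}^d)^{N+1}$ of the shifted discrete fractional Pontryagin's system, the following equality holds: $$\Delta^1_-\left[\sum_{r=1}^N A_r\times\left(\frac{\partial\phi_1}{\partial s}(0,Q)\cdot\sigma^{r-1}(P)\right)\right]=0 .$$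
   Context: Setting. $a<b$ are reals, $d,m\in\mathbb{N}^*$, $0<\alpha\le 1$, $A\in\mathbb{R}^d$, $N\in\mathbb{N}^*$, $h=(b-a)/N$, $t_k=a+kh$ for $k=0,\dots,N$. $\|\cdot\|$ is the Euclidean norm and $\cdot$ the Euclidean inner product. A Lagrangian is a $C^2$ function $L:\mathbb{R}^d\times\mathbb{R}^m\times[a,b]\to\mathbb{R}$, $(x,v,t)\mapsto L(x,v,t)$. A constraint function is a $C^2$ function $f:\mathbb{R}^d\times\mathbb{R}^m\times[a,b]\to\mathbb{R}^d$, $(x,v,t)\mapsto f(x,v,t)$, for which there is $M\ge 0$ with $\|f(x_1,v,t)-f(x_2,v,t)\|\le M\|x_1-x_2\|$ for all $x_1,x_2,v,t$. It is assumed that $2h^\alpha M<1$. The Hamiltonian is $H(x,v,w,t)=L(x,v,t)+w\cdot f(x,v,t)$ on $\mathbb{R}^d\times\mathbb{R}^m\times\mathbb{R}^d\times[a,b]$. Discrete derivatives. Let $\alpha_0=1$ and $\alpha_r=\frac{(-\alpha)(1-\alpha)\cdots(r-1-\alpha)}{r!}$ for $r\ge1$. For $G=(G_k)_{k=0,\dots,N}\in(\mathbb{R}^d)^{N+1}$, put $(\Delta^\alpha_-G)_k=h^{-\alpha}\sum_{r=0}^k\alpha_rG_{k-r}$ and $({}_{\mathrm{c}}\Delta^\alpha_-G)_k=h^{-\alpha}\sum_{r=0}^k\alpha_r(G_{k-r}-G_0)$ for $k=1,\dots,N$, and $(\Delta^\alpha_+G)_k=h^{-\alpha}\sum_{r=0}^{N-k}\alpha_rG_{k+r}$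 for $k=0,\dots,N-1$. For $G\in\mathbb{R}^{N+1}$, $(\Delta^1_-G)_k=(G_k-G_{k-1})/h$, $k=1,\dots,N$. Shifted discrete fractional Pontryagin's system for $(Q,U,P)$: $({}_{\mathrm{c}}\Delta^\alpha_-Q)_k=\frac{\partial H}{\partial w}(Q_k,U_k,P_{k-1},t_k)$ for $k=1,\dots,N$; $(\Delta^\alpha_+P)_k=\frac{\partial H}{\partial x}(Q_{k+1},U_{k+1},P_k,t_{k+1})$ for $k=0,\dots,N-1$; $\frac{\partial H}{\partial v}(Q_k,U_k,P_{k-1},t_k)=0$ for $k=1,\dots,N$; $Q_0=A$, $P_N=0$. One parameter group of diffeomorphisms of $\mathbb{R}^n$: a family $\{\phi(s,\cdot)\}_{s\in\mathbb{R}}$ of diffeomorphisms of $\mathbb{R}^n$ with $\phi(0,\cdot)=\mathrm{Id}$, $\phi(s,\cdot)\circ\phi(s',\cdot)=\phi(s+s',\cdot)$ for all $s,s'\in\mathbb{R}$, and $\phi:\mathbb{R}\times\mathbb{R}^n\to\mathbb{R}^n$ of class $C^2$. We write $\phi_1(s,Q)=(\phi_1(s,Q_k))_{k=0,\dots,N}$ and $\frac{\partial\phi_1}{\partial s}(0,Q)=\left(\frac{\partial\phi_1}{\partial s}(0,Q_k)\right)_{k=0,\dots,N}$. Invariance. $H$ is ${}_{\mathrm{c}}\Delta^\alpha_-$-invariant under the action of $(\Phi_i)_{i=1,2,3}$ if for every solution $(Q,U,P)$ of the shifted discrete fractional Pontryagin's system, every $s\in\mathbb{R}$ and every $k=1,\dots,N$: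 $$H\big(\phi_1(s,Q_k),\phi_2(s,U_k),\phi_3(s,P_{k-1}),t_k\big)-\phi_3(s,P_{k-1})\cdot\big({}_{\mathrm{c}}\Delta^\alpha_-(\phi_1(s,Q))\big)_k=H(Q_k,U_k,P_{k-1},t_k)-P_{k-1}\cdot({}_{\mathrm{c}}\Delta^\alpha_-Q)_k .$$ Shifts and products. $\sigma^{r-1}(P)_j=P_{j+r-1}$ ($\sigma^0$ is the identity), with $\sigma^{r-1}(P)_j:=0$ if $j+r-1>N$ (these entries are always multiplied by zero coefficients below). For sequences $G^1,G^2$ of vectors, $G^1\cdot G^2$ is the sequence $(G^1_j\cdot G^2_j)_j$; here $\frac{\partial\phi_1}{\partial s}(0,Q)\cdot\sigma^{r-1}(P)$ is a vector in $\mathbb{R}^{N+1}$ and $A_r\times$ denotes matrix-vector multiplication. Matrices (of size $N+1$, indices $i,j=0,\dots,N$; $\delta_{\{\cdot\}}$ equals 1 if the condition holds and 0 otherwise). $B_1=\mathrm{Id}_{N+1}$; for $r=2,\dots,N$, $(B_r)_{i,j}=\delta_{\{1\le i\le N-1\}}\delta_{\{1\le j\le N-r\}}\delta_{\{0\le i-j\le r-1\}}-\delta_{\{j=0\}}\delta_{\{r\le i\}}$; for $r=1,\dots,N$, $(C_r)_{i,j}=\delta_{\{r\le i\}}\delta_{\{j=0\}}$. Finally $A_r=\alpha_rB_r+\beta^\alpha_rC_r$ for $r=1,\dots,N$, where $\beta^\alpha_r=\sum_{k=0}^r\alpha_k$. *)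

theory Defs
  imports "HOL-Analysis.Analysis"
begin

text \<open>
  Derivatives are Frechet derivatives relative to \<open>S\<close>. The sets used below are the whole space and
  \<open>UNIV \<times> UNIV \<times> {a..b}\<close> with \<open>a < b\<close>; there the relative derivative is unique, and it is
  one-sided in the last variable at the end points of \<open>{a..b}\<close>.
\<close>

definition C1_on :: "'a::real_normed_vector set \<Rightarrow> ('a \<Rightarrow> 'b::real_normed_vector) \<Rightarrow> bool" where
  "C1_on S g \<longleftrightarrow> (\<exists>g' :: 'a \<Rightarrow> 'a \<Rightarrow>\<^sub>L 'b.
     (\<forall>x\<in>S. (g has_derivative blinfun_apply (g' x)) (at x within S)) \<and> continuous_on S g')"

definition C2_on :: "'a::real_normed_vector set \<Rightarrow> ('a \<Rightarrow> 'b::real_normed_vector) \<Rightarrow> bool" where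
  "C2_on S g \<longleftrightarrow> (\<exists>g' :: 'a \<Rightarrow> 'a \<Rightarrow>\<^sub>L 'b.
     (\<forall>x\<in>S. (g has_derivative blinfun_apply (g' x)) (at x within S)) \<and> C1_on S g')"

definition gradient :: "('a::real_inner \<Rightarrow> real) \<Rightarrow> 'a \<Rightarrow> 'a" where
  "gradient g x = (THE D. GDERIV g x :> D)"

definition diffeomorphism :: "('a::real_normed_vector \<Rightarrow> 'a) \<Rightarrow> bool" where
  "diffeomorphism g \<longleftrightarrow> bij g \<and> C1_on UNIV g \<and> C1_on UNIV (inv g)"

definition one_parameter_group :: "(real \<Rightarrow> 'a::real_normed_vector \<Rightarrow> 'a) \<Rightarrow> bool" where
  "one_parameter_group \<phi> \<longleftrightarrow>
     (\<forall>s. diffeomorphism (\<phi> s)) \<and>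
     \<phi> 0 = id \<and>
     (\<forall>s s'. \<phi> s \<circ> \<phi> s' = \<phi> (s + s')) \<and>
     C2_on UNIV (\<lambda>(s, x). \<phi> s x)"

text \<open>
  Functions on \<open>\<real>\<^sup>d \<times> \<real>\<^sup>m \<times> [a, b]\<close> are represented by total functions; their values at times
  outside \<open>{a..b}\<close> are never used.
\<close>

definition lagrangian :: "real \<Rightarrow> real \<Rightarrow> (real^'d \<Rightarrow> real^'m \<Rightarrow> real \<Rightarrow> real) \<Rightarrow> bool" where
  "lagrangian a b L \<longleftrightarrow> C2_on (UNIV \<times> UNIV \<times> {a..b}) (\<lambda>(x, v, t). L x v t)"

definition constraint_function ::
  "real \<Rightarrow> real \<Rightarrow> real \<Rightarrow> (real^'d \<Rightarrow> real^'m \<Rightarrow> real \<Rightarrow> real^'d) \<Rightarrow> bool" where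
  "constraint_function a b M f \<longleftrightarrow>
     C2_on (UNIV \<times> UNIV \<times> {a..b}) (\<lambda>(x, v, t). f x v t) \<and>
     0 \<le> M \<and>
     (\<forall>x1 x2 v. \<forall>t\<in>{a..b}. norm (f x1 v t - f x2 v t) \<le> M * norm (x1 - x2))"

definition hamiltonian ::
  "(real^'d \<Rightarrow> real^'m \<Rightarrow> real \<Rightarrow> real) \<Rightarrow> (real^'d \<Rightarrow> real^'m \<Rightarrow> real \<Rightarrow> real^'d) \<Rightarrow>
   real^'d \<Rightarrow> real^'m \<Rightarrow> real^'d \<Rightarrow> real \<Rightarrow> real" where
  "hamiltonian L f x v w t = L x v t + w \<bullet> f x v t"

text \<open>
  A family indexed by \<open>0, \<dots>, N\<close> is represented by a function on \<open>nat\<close>; nothing below reads an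
  entry with index greater than \<open>N\<close>.
\<close>

definition step :: "real \<Rightarrow> real \<Rightarrow> nat \<Rightarrow> real" where
  "step a b N = (b - a) / real N"

definition node :: "real \<Rightarrow> real \<Rightarrow> nat \<Rightarrow> nat \<Rightarrow> real" where
  "node a b N k = a + real k * step a b N"

text \<open>\<open>pochhammer (-\<alpha>) r\<close> is the product \<open>(-\<alpha>) (1 - \<alpha>) \<dots> (r - 1 - \<alpha>)\<close>, equal to 1 for \<open>r = 0\<close>.\<close>

definition frac_coeff :: "real \<Rightarrow> nat \<Rightarrow> real" where
  "frac_coeff \<alpha> r = pochhammer (- \<alpha>) r / fact r"

definition frac_coeff_sum :: "real \<Rightarrow> nat \<Rightarrow> real" where
  "frac_coeff_sum \<alpha> r = (\<Sum>k=0..r. frac_coeff \<alpha> k)"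

definition caputo_minus :: "real \<Rightarrow> real \<Rightarrow> (nat \<Rightarrow> 'a::real_vector) \<Rightarrow> nat \<Rightarrow> 'a" where
  "caputo_minus h \<alpha> G k =
     (h powr (- \<alpha>)) *\<^sub>R (\<Sum>r=0..k. frac_coeff \<alpha> r *\<^sub>R (G (k - r) - G 0))"

definition delta_plus :: "real \<Rightarrow> real \<Rightarrow> nat \<Rightarrow> (nat \<Rightarrow> 'a::real_vector) \<Rightarrow> nat \<Rightarrow> 'a" where
  "delta_plus h \<alpha> N G k =
     (h powr (- \<alpha>)) *\<^sub>R (\<Sum>r=0..N - k. frac_coeff \<alpha> r *\<^sub>R G (k + r))"

definition delta1_minus :: "real \<Rightarrow> (nat \<Rightarrow> real) \<Rightarrow> nat \<Rightarrow> real" where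
  "delta1_minus h G k = (G k - G (k - 1)) / h"

definition pontryagin_solution ::
  "real \<Rightarrow> real \<Rightarrow> nat \<Rightarrow> real \<Rightarrow> real^'d \<Rightarrow> (real^'d \<Rightarrow> real^'m \<Rightarrow> real^'d \<Rightarrow> real \<Rightarrow> real) \<Rightarrow>
   (nat \<Rightarrow> real^'d) \<Rightarrow> (nat \<Rightarrow> real^'m) \<Rightarrow> (nat \<Rightarrow> real^'d) \<Rightarrow> bool" where
  "pontryagin_solution a b N \<alpha> A H Q U P \<longleftrightarrow>
     (\<forall>k\<in>{1..N}. caputo_minus (step a b N) \<alpha> Q k =
        gradient (\<lambda>w. H (Q k) (U k) w (node a b N k)) (P (k - 1))) \<and>
     (\<forall>k\<in>{0..<N}. delta_plus (step a b N) \<alpha> N P k =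
        gradient (\<lambda>x. H x (U (k + 1)) (P k) (node a b N (k + 1))) (Q (k + 1))) \<and>
     (\<forall>k\<in>{1..N}. gradient (\<lambda>v. H (Q k) v (P (k - 1)) (node a b N k)) (U k) = 0) \<and>
     Q 0 = A \<and> P N = 0"

definition caputo_invariant ::
  "real \<Rightarrow> real \<Rightarrow> nat \<Rightarrow> real \<Rightarrow> real^'d \<Rightarrow> (real^'d \<Rightarrow> real^'m \<Rightarrow> real^'d \<Rightarrow> real \<Rightarrow> real) \<Rightarrow>
   (real \<Rightarrow> real^'d \<Rightarrow> real^'d) \<Rightarrow> (real \<Rightarrow> real^'m \<Rightarrow> real^'m) \<Rightarrow> (real \<Rightarrow> real^'d \<Rightarrow> real^'d) \<Rightarrow> bool"
where
  "caputo_invariant a b N \<alpha> A H \<phi>1 \<phi>2 \<phi>3 \<longleftrightarrow>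
     (\<forall>Q U P. pontryagin_solution a b N \<alpha> A H Q U P \<longrightarrow>
       (\<forall>s. \<forall>k\<in>{1..N}.
          H (\<phi>1 s (Q k)) (\<phi>2 s (U k)) (\<phi>3 s (P (k - 1))) (node a b N k)
            - \<phi>3 s (P (k - 1)) \<bullet> caputo_minus (step a b N) \<alpha> (\<lambda>j. \<phi>1 s (Q j)) k
          = H (Q k) (U k) (P (k - 1)) (node a b N k)
            - P (k - 1) \<bullet> caputo_minus (step a b N) \<alpha> Q k))"

definition shift :: "nat \<Rightarrow> nat \<Rightarrow> (nat \<Rightarrow> 'a::zero) \<Rightarrow> nat \<Rightarrow> 'a" where
  "shift N n P j = (if j + n \<le> N then P (j + n) else 0)"

text \<open>
  Square matrices of size \<open>N + 1\<close> are functions of two indices ranging over \<open>0, \<dots>, N\<close>. In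
  \<open>matB\<close>, the conditions \<open>i < N\<close>, \<open>j + r \<le> N\<close> and \<open>j \<le> i \<and> i < j + r\<close> are \<open>i \<le> N - 1\<close>, \<open>j \<le> N - r\<close>
  and \<open>0 \<le> i - j \<le> r - 1\<close> written without truncated subtraction.
\<close>

definition matB :: "nat \<Rightarrow> nat \<Rightarrow> nat \<Rightarrow> nat \<Rightarrow> real" where
  "matB N r i j =
     (if r = 1 then of_bool (i = j)
      else of_bool (1 \<le> i \<and> i < N) * of_bool (1 \<le> j \<and> j + r \<le> N) * of_bool (j \<le> i \<and> i < j + r)
           - of_bool (j = 0) * of_bool (r \<le> i))"

definition matC :: "nat \<Rightarrow> nat \<Rightarrow> nat \<Rightarrow> real" where
  "matC r i j = of_bool (r \<le> i) * of_bool (j = 0)"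

definition matA :: "real \<Rightarrow> nat \<Rightarrow> nat \<Rightarrow> nat \<Rightarrow> nat \<Rightarrow> real" where
  "matA \<alpha> N r i j = frac_coeff \<alpha> r * matB N r i j + frac_coeff_sum \<alpha> r * matC r i j"

definition mat_vec :: "nat \<Rightarrow> (nat \<Rightarrow> nat \<Rightarrow> real) \<Rightarrow> (nat \<Rightarrow> real) \<Rightarrow> nat \<Rightarrow> real" where
  "mat_vec N X y i = (\<Sum>j=0..N. X i j * y j)"

end

theory Submission
  imports Defs
begin

text \<open>
  Differentiating the invariance identity at \<open>s = 0\<close> and inserting the three stationarity equations
  of Pontryagin's system leaves, with \<open>Y j\<close> the derivative of \<open>\<phi>1 s (Q j)\<close> at \<open>s = 0\<close>, the identity
  \<open>delta_plus P (k - 1) \<bullet> Y k = P (k - 1) \<bullet> caputo_minus Y k\<close>. The matrices are built so that row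
  \<open>k\<close> minus row \<open>k - 1\<close> of the sum over \<open>r\<close> is exactly the difference of its two sides, up to the
  factor \<open>h powr (- \<alpha>)\<close>.
\<close>

section \<open>Gradients and joint derivatives\<close>

text \<open>\<open>gradient\<close> is a definite description, so it can be evaluated only once a
  unique candidate is known. The candidate is the Riesz vector of \<open>g'\<close>, read off on
  \<open>Basis\<close>; uniqueness is that of the Frechet derivative.\<close>

lemma gradient_has_derivative:
  fixes g :: "'a::euclidean_space \<Rightarrow> real"
  assumes "(g has_derivative g') (at x)"
  shows "g' u = u \<bullet> gradient g x"
proof -
  interpret bounded_linear g'
    using assms by (rule has_derivative_bounded_linear)
  define D where "D = (\<Sum>b\<in>Basis. g' b *\<^sub>R b)"
  have g': "g' v = v \<bullet> D" for v
  proof -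
    have "g' v = g' (\<Sum>b\<in>Basis. (v \<bullet> b) *\<^sub>R b)"
      by (simp add: euclidean_representation)
    also have "\<dots> = v \<bullet> D"
      by (simp add: D_def sum scaleR inner_sum_right mult.commute)
    finally show ?thesis .
  qed
  then have "g' = (\<lambda>v. v \<bullet> D)"
    by auto
  then have D: "GDERIV g x :> D"
    using assms by (simp add: gderiv_def inner_commute)
  then have "gradient g x = D"
    unfolding gradient_def
  proof (rule the_equality)
    fix D' assume "GDERIV g x :> D'"
    with D have "(\<lambda>v. v \<bullet> D') = (\<lambda>v. v \<bullet> D)"
      unfolding gderiv_def by (rule has_derivative_unique[rotated])
    then show "D' = D"
      by (metis vector_eq_ldot)
  qed
  with g' show ?thesis
    by simp
qed

text \<open>A total derivative is linear, so it splits over the three coordinate directions; by the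
  chain rule with an affine embedding, each piece is the derivative in one argument with the other
  two frozen.\<close>

lemma has_derivative_partial_gradients:
  fixes F :: "'a::euclidean_space \<Rightarrow> 'b::euclidean_space \<Rightarrow> 'c::euclidean_space \<Rightarrow> real"
  assumes F: "((\<lambda>(x, v, w). F x v w) has_derivative F') (at (x, v, w))"
  shows "F' (dx, dv, dw) =
    dx \<bullet> gradient (\<lambda>x. F x v w) x + dv \<bullet> gradient (\<lambda>v. F x v w) v + dw \<bullet> gradient (\<lambda>w. F x v w) w"
proof -
  interpret bounded_linear F'
    using F by (rule has_derivative_bounded_linear)
  have "((\<lambda>x. (x, v, w)) has_derivative (\<lambda>u. (u, 0, 0))) (at x)"
    by (auto intro!: derivative_eq_intros simp: zero_prod_def)
  from has_derivative_compose[OF this F]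
  have 1: "((\<lambda>x. F x v w) has_derivative (\<lambda>u. F' (u, 0, 0))) (at x)"
    by simp
  have "((\<lambda>v. (x, v, w)) has_derivative (\<lambda>u. (0, u, 0))) (at v)"
    by (auto intro!: derivative_eq_intros simp: zero_prod_def)
  from has_derivative_compose[OF this F]
  have 2: "((\<lambda>v. F x v w) has_derivative (\<lambda>u. F' (0, u, 0))) (at v)"
    by simp
  have "((\<lambda>w. (x, v, w)) has_derivative (\<lambda>u. (0, 0, u))) (at w)"
    by (auto intro!: derivative_eq_intros simp: zero_prod_def)
  from has_derivative_compose[OF this F]
  have 3: "((\<lambda>w. F x v w) has_derivative (\<lambda>u. F' (0, 0, u))) (at w)"
    by simp
  have "F' (dx, dv, dw) = F' (dx, 0, 0) + F' (0, dv, 0) + F' (0, 0, dw)"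
    by (simp flip: add)
  then show ?thesis
    using gradient_has_derivative[OF 1] gradient_has_derivative[OF 2] gradient_has_derivative[OF 3]
    by simp
qed

section \<open>Differentiability of the Hamiltonian at a fixed time\<close>

text \<open>Freezing \<open>t\<close> embeds the whole space of pairs \<open>(x, v)\<close> into the
  set carrying the relative derivative. The chain rule along this embedding therefore gives an
  unrestricted derivative, even if \<open>t\<close> is an end point of a time interval.\<close>

lemma C2_on_slice_differentiable:
  fixes g :: "'a::real_normed_vector \<Rightarrow> 'b::real_normed_vector \<Rightarrow> 'c::real_normed_vector
    \<Rightarrow> 'd::real_normed_vector"
  assumes g: "C2_on (UNIV \<times> UNIV \<times> T) (\<lambda>(x, v, t). g x v t)" and t: "t \<in> T"
  shows "(\<lambda>(x, v). g x v t) differentiable (at z)"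
proof -
  obtain g' where
    "((\<lambda>(x, v, t). g x v t) has_derivative g') (at (fst z, snd z, t) within UNIV \<times> UNIV \<times> T)"
    using g t unfolding C2_on_def by (metis SigmaI UNIV_I)
  then have 1: "((\<lambda>(x, v, t). g x v t) has_derivative g')
      (at (fst z, snd z, t) within (\<lambda>z. (fst z, snd z, t)) ` UNIV)"
    by (rule has_derivative_subset) (use t in auto)
  have 2: "((\<lambda>z. (fst z, snd z, t)) has_derivative (\<lambda>u. (fst u, snd u, 0))) (at z)"
    by (auto intro!: derivative_eq_intros)
  from diff_chain_within[OF 2 1] show ?thesis
    unfolding differentiable_def o_def case_prod_beta by auto
qed

lemma hamiltonian_differentiable:
  assumes "lagrangian a b L" "constraint_function a b M f" "t \<in> {a..b}"
  shows "(\<lambda>(x, v, w). hamiltonian L f x v w t) differentiable (at z)"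
proof -
  have proj: "(\<lambda>z :: (real^'a) \<times> (real^'b) \<times> (real^'a). (fst z, fst (snd z))) differentiable (at z)"
    unfolding differentiable_def
    by (rule exI, (rule derivative_intros)+)
  have "(\<lambda>(x, v). L x v t) differentiable (at (fst z, fst (snd z)))"
       "(\<lambda>(x, v). f x v t) differentiable (at (fst z, fst (snd z)))"
    using assms unfolding lagrangian_def constraint_function_def
    by (auto intro: C2_on_slice_differentiable)
  from this(1)[THEN differentiable_compose[where g = "\<lambda>z. (fst z, fst (snd z))"], OF proj]
    this(2)[THEN differentiable_compose[where g = "\<lambda>z. (fst z, fst (snd z))"], OF proj]
  have "(\<lambda>z. L (fst z) (fst (snd z)) t) differentiable (at z)"
       "(\<lambda>z. f (fst z) (fst (snd z)) t) differentiable (at z)"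
    by simp_all
  moreover have "(\<lambda>z :: (real^'a) \<times> (real^'b) \<times> (real^'a). snd (snd z)) differentiable (at z)"
    unfolding differentiable_def
    by (rule exI, (rule derivative_intros)+)
  ultimately show ?thesis
    unfolding hamiltonian_def case_prod_beta
    by (auto intro!: differentiable_add differentiable_inner)
qed

section \<open>Derivatives in the group parameter\<close>

lemma one_parameter_group_zero: "one_parameter_group \<phi> \<Longrightarrow> \<phi> 0 x = x"
  by (simp add: one_parameter_group_def)

lemma one_parameter_group_has_vector_derivative:
  assumes "one_parameter_group \<phi>"
  shows "((\<lambda>s. \<phi> s x) has_vector_derivative vector_derivative (\<lambda>s. \<phi> s x) (at 0)) (at 0)"
proof -
  obtain g' where 1: "((\<lambda>(s, x). \<phi> s x) has_derivative g') (at (0, x))"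
    using assms unfolding one_parameter_group_def C2_on_def by blast
  have "((\<lambda>s. (s, x)) has_derivative (\<lambda>u. (u, 0))) (at (0::real))"
    by (auto intro!: derivative_eq_intros)
  from has_derivative_compose[OF this 1]
  have "(\<lambda>s. \<phi> s x) differentiable (at 0)"
    by (auto simp: differentiable_def)
  then show ?thesis
    by (simp add: vector_derivative_works)
qed

text \<open>The discrete derivative is a finite linear combination with coefficients free of
  \<open>s\<close>, so differentiation in \<open>s\<close> passes through it.\<close>

lemma caputo_minus_has_vector_derivative:
  assumes "\<And>j. ((\<lambda>s. G s j) has_vector_derivative G' j) F"
  shows "((\<lambda>s. caputo_minus h \<alpha> (G s) k) has_vector_derivative caputo_minus h \<alpha> G' k) F"
  unfolding caputo_minus_def
  by (intro bounded_linear.has_vector_derivative[OF bounded_linear_scaleR_right]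
      has_vector_derivative_sum has_vector_derivative_diff assms)

section \<open>Row differences of the matrices\<close>

text \<open>Passing from row \<open>k - 1\<close> to row \<open>k\<close> changes entries only in
  the columns \<open>k\<close>, \<open>k - r\<close> and \<open>0\<close>. Where
  \<open>k - r\<close> would truncate, the factor \<open>of_bool (r < k)\<close> is 0. The condition
  on \<open>z N\<close> serves the identity matrix at \<open>r = 1\<close>: it has an entry in
  column \<open>N\<close>, which the bound \<open>k + r \<le> N\<close> leaves out, while the bands
  for larger \<open>r\<close> never reach that column.\<close>

lemma matA_row_diff:
  assumes r: "1 \<le> r" and k: "1 \<le> k" "k \<le> N" and j: "j \<le> N" and z: "r = 1 \<Longrightarrow> z N = 0"
  shows "(matA \<alpha> N r k j - matA \<alpha> N r (k - 1) j) * z j =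
    (if j = k then of_bool (k + r \<le> N) * frac_coeff \<alpha> r * z k else 0)
    - (if j = k - r then of_bool (r < k) * frac_coeff \<alpha> r * z (k - r) else 0)
    + (if j = 0 then of_bool (r = k) * frac_coeff_sum \<alpha> (k - 1) * z 0 else 0)"
proof -
  obtain l where l: "k = Suc l"
    using k by (cases k) auto
  then have l': "k - 1 = l"
    by simp
  \<comment> \<open>In column 0 with \<open>r = k\<close> the matrices \<open>B\<close> and
    \<open>C\<close> jump by -1 and 1. This recurrence reduces the resulting coefficient to the sum
    up to \<open>k - 1\<close>.\<close>
  have sum: "frac_coeff_sum \<alpha> (Suc l) = frac_coeff_sum \<alpha> l + frac_coeff \<alpha> (Suc l)"
    by (simp add: frac_coeff_sum_def)
  have C: "matC r k j - matC r l j = of_bool (j = 0 \<and> r = k)"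
    by (auto simp: matC_def l)
  have A: "matA \<alpha> N r k j - matA \<alpha> N r l j = frac_coeff \<alpha> r * (matB N r k j - matB N r l j)
      + frac_coeff_sum \<alpha> r * (matC r k j - matC r l j)"
    by (simp add: matA_def algebra_simps)
  show ?thesis
  proof (cases "r = 1")
    case True
    have "matB N r k j - matB N r l j = of_bool (j = k) - of_bool (j = l)"
      by (auto simp: matB_def True l)
    then have D: "matA \<alpha> N r k j - matA \<alpha> N r l j =
        frac_coeff \<alpha> r * (of_bool (j = k) - of_bool (j = l))
        + frac_coeff_sum \<alpha> r * of_bool (j = 0 \<and> r = k)"
      by (simp add: A C)
    show ?thesis
      unfolding l' D using True k z sum l by (cases "k = N"; cases "l = 0") (auto simp: algebra_simps)
  next
    case False
    \<comment> \<open>For \<open>1 \<le> j\<close> and \<open>j + r \<le> N\<close>, column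
      \<open>j\<close> is a run of ones in the rows from \<open>j\<close> to
      \<open>j + r - 1\<close>, so consecutive rows differ only where the run starts or has just
      ended. Column 0 drops by 1 at row \<open>r\<close>.\<close>
    have "matB N r k j - matB N r l j =
        of_bool (j = k \<and> k + r \<le> N) - of_bool (j + r = k \<and> 1 \<le> j) - of_bool (j = 0 \<and> r = k)"
    proof (cases "j = 0")
      case True
      then show ?thesis
        using \<open>r \<noteq> 1\<close> by (auto simp: matB_def l)
    next
      case j0: False
      consider "j = k" | "j + r = k" | "j \<noteq> k" "j + r \<noteq> k"
        by blast
      then show ?thesis
        using j0 r k False by cases (auto simp: matB_def l of_bool_def)
    qed
    then have D: "matA \<alpha> N r k j - matA \<alpha> N r l j =
        frac_coeff \<alpha> r * (of_bool (j = k \<and> k + r \<le> N) - of_bool (j + r = k \<and> 1 \<le> j)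
          - of_bool (j = 0 \<and> r = k))
        + frac_coeff_sum \<alpha> r * of_bool (j = 0 \<and> r = k)"
      by (simp add: A C)
    have "j + r = k \<and> 1 \<le> j \<longleftrightarrow> j = k - r \<and> r < k"
      by auto
    then show ?thesis
      unfolding l' D using r k sum l by (cases "j = 0"; cases "r = k") (auto simp: algebra_simps)
  qed
qed

lemma mat_vec_matA_diff:
  assumes "1 \<le> r" "1 \<le> k" "k \<le> N" "r = 1 \<Longrightarrow> z N = 0"
  shows "mat_vec N (matA \<alpha> N r) z k - mat_vec N (matA \<alpha> N r) z (k - 1) =
    of_bool (k + r \<le> N) * frac_coeff \<alpha> r * z k
    - of_bool (r < k) * frac_coeff \<alpha> r * z (k - r)
    + of_bool (r = k) * frac_coeff_sum \<alpha> (k - 1) * z 0"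
proof -
  have "mat_vec N (matA \<alpha> N r) z k - mat_vec N (matA \<alpha> N r) z (k - 1) =
      (\<Sum>j=0..N. (matA \<alpha> N r k j - matA \<alpha> N r (k - 1) j) * z j)"
    by (simp add: mat_vec_def sum_subtractf left_diff_distrib)
  also have "\<dots> = (\<Sum>j=0..N.
      (if j = k then of_bool (k + r \<le> N) * frac_coeff \<alpha> r * z k else 0)
      - (if j = k - r then of_bool (r < k) * frac_coeff \<alpha> r * z (k - r) else 0)
      + (if j = 0 then of_bool (r = k) * frac_coeff_sum \<alpha> (k - 1) * z 0 else 0))"
    using assms by (intro sum.cong refl matA_row_diff) auto
  also have "\<dots> = of_bool (k + r \<le> N) * frac_coeff \<alpha> r * z k
      - of_bool (r < k) * frac_coeff \<alpha> r * z (k - r)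
      + of_bool (r = k) * frac_coeff_sum \<alpha> (k - 1) * z 0"
    using assms by (auto simp: sum.distrib sum_subtractf)
  finally show ?thesis .
qed

text \<open>This is a discrete integration by parts. Column \<open>k\<close> pairs
  \<open>Y k\<close> with \<open>P (k - 1 + r)\<close> and gives the right-sided sum; column
  \<open>k - r\<close> pairs \<open>Y (k - r)\<close> with \<open>P (k - 1)\<close> and gives the
  left-sided one; column 0 supplies the Caputo correction by \<open>Y 0\<close>. The term
  \<open>Y k \<bullet> P (k - 1)\<close> that \<open>r = 0\<close> contributes to both sums
  cancels.\<close>

lemma sum_mat_vec_matA_diff:
  fixes Y P :: "nat \<Rightarrow> 'a::real_inner" and \<alpha> :: real
  assumes k: "1 \<le> k" "k \<le> N" and P: "P N = 0"
  defines "S \<equiv> \<lambda>i. \<Sum>r=1..N. mat_vec N (matA \<alpha> N r) (\<lambda>j. Y j \<bullet> shift N (r - 1) P j) i"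
  shows "S k - S (k - 1) =
    (\<Sum>r=0..N - (k - 1). frac_coeff \<alpha> r *\<^sub>R P (k - 1 + r)) \<bullet> Y k
    - P (k - 1) \<bullet> (\<Sum>r=0..k. frac_coeff \<alpha> r *\<^sub>R (Y (k - r) - Y 0))"
proof -
  let ?c = "frac_coeff \<alpha>" and ?b = "frac_coeff_sum \<alpha> (k - 1)"
  define p where "p = P (k - 1)"
  have c0: "?c 0 = 1"
    by (simp add: frac_coeff_def)
  have "S k - S (k - 1) = (\<Sum>r=1..N.
      of_bool (k + r \<le> N) * ?c r * (Y k \<bullet> shift N (r - 1) P k)
      - of_bool (r < k) * ?c r * (Y (k - r) \<bullet> shift N (r - 1) P (k - r))
      + of_bool (r = k) * ?b * (Y 0 \<bullet> shift N (r - 1) P 0))"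
    unfolding S_def sum_subtractf[symmetric]
    using k P by (intro sum.cong refl mat_vec_matA_diff) (auto simp: shift_def)
  \<comment> \<open>The shift compensates for the column: \<open>(k - r) + (r - 1)\<close> and, for
    \<open>r = k\<close>, also \<open>0 + (r - 1)\<close> equal \<open>k - 1\<close>, so the single
    vector \<open>p\<close> appears.\<close>
  also have "\<dots> = (\<Sum>r=1..N.
      (if k + r \<le> N then ?c r * (Y k \<bullet> P (k - 1 + r)) else 0)
      - (if r < k then ?c r * (Y (k - r) \<bullet> p) else 0)
      + (if r = k then ?b * (Y 0 \<bullet> p) else 0))"
    using k by (intro sum.cong refl) (auto simp: shift_def p_def)
  also have "\<dots> = (\<Sum>r=1..N. if k + r \<le> N then ?c r * (Y k \<bullet> P (k - 1 + r)) else 0)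
      - (\<Sum>r=1..N. if r < k then ?c r * (Y (k - r) \<bullet> p) else 0) + ?b * (Y 0 \<bullet> p)"
    using k by (simp add: sum.distrib sum_subtractf)
  \<comment> \<open>The one extra index \<open>r = N - (k - 1)\<close> adds a multiple of
    \<open>P N\<close>, which is 0.\<close>
  also have "(\<Sum>r=1..N. if k + r \<le> N then ?c r * (Y k \<bullet> P (k - 1 + r)) else 0)
      = (\<Sum>r=1..N - (k - 1). ?c r * (Y k \<bullet> P (k - 1 + r)))"
  proof (intro sum.mono_neutral_cong_right ballI)
    fix r assume "r \<in> {1..N - (k - 1)}"
    then have "k + r \<le> N \<or> k - 1 + r = N"
      using k by auto
    then show "(if k + r \<le> N then ?c r * (Y k \<bullet> P (k - 1 + r)) else 0)
        = ?c r * (Y k \<bullet> P (k - 1 + r))"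
      using P by auto
  qed (use k in auto)
  also have "\<dots> = (\<Sum>r=0..N - (k - 1). ?c r *\<^sub>R P (k - 1 + r)) \<bullet> Y k - Y k \<bullet> p"
    by (simp add: sum.atLeast_Suc_atMost c0 inner_add_right inner_sum_right
        inner_commute[of _ "Y k"] p_def)
  also have "(\<Sum>r=1..N. if r < k then ?c r * (Y (k - r) \<bullet> p) else 0)
      = (\<Sum>r=1..k - 1. ?c r * (Y (k - r) \<bullet> p))"
    using k by (intro sum.mono_neutral_cong_right) auto
  also have "\<dots> = p \<bullet> (\<Sum>r=0..k. ?c r *\<^sub>R (Y (k - r) - Y 0)) - Y k \<bullet> p + ?b * (Y 0 \<bullet> p)"
  proof -
    \<comment> \<open>The summand at \<open>r = k\<close> contains \<open>Y 0 - Y 0\<close>, so the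
      sum stops at \<open>k - 1\<close>; hence \<open>Y 0\<close> carries the coefficient sum up to
      \<open>k - 1\<close>, as in the matrices.\<close>
    have "p \<bullet> (\<Sum>r=0..k. ?c r *\<^sub>R (Y (k - r) - Y 0))
        = (\<Sum>r=0..k - 1. ?c r * (Y (k - r) \<bullet> p - Y 0 \<bullet> p))"
      using k by (cases k)
        (simp_all add: inner_sum_right inner_add_right inner_diff_right inner_commute)
    also have "\<dots> = (\<Sum>r=0..k - 1. ?c r * (Y (k - r) \<bullet> p)) - ?b * (Y 0 \<bullet> p)"
      by (simp add: right_diff_distrib sum_subtractf sum_distrib_right frac_coeff_sum_def)
    also have "(\<Sum>r=0..k - 1. ?c r * (Y (k - r) \<bullet> p))
        = Y k \<bullet> p + (\<Sum>r=1..k - 1. ?c r * (Y (k - r) \<bullet> p))"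
      by (simp add: sum.atLeast_Suc_atMost c0)
    finally show ?thesis
      by simp
  qed
  finally show ?thesis
    by (simp add: p_def)
qed

section \<open>The differentiated invariance identity\<close>

text \<open>The velocities of the three group actions enter linearly: the terms in \<open>W\<close>
  cancel by the equation for \<open>Q\<close>, the term in \<open>V\<close> vanishes by stationarity
  in \<open>v\<close>, and only \<open>Y\<close> survives.\<close>

lemma caputo_invariant_derivative:
  fixes L :: "real^'d \<Rightarrow> real^'m \<Rightarrow> real \<Rightarrow> real"
  assumes ab: "a < b"
    and L: "lagrangian a b L" and f: "constraint_function a b M f"
    and groups: "one_parameter_group \<phi>1" "one_parameter_group \<phi>2" "one_parameter_group \<phi>3"
    and inv: "caputo_invariant a b N \<alpha> A (hamiltonian L f) \<phi>1 \<phi>2 \<phi>3"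
    and sol: "pontryagin_solution a b N \<alpha> A (hamiltonian L f) Q U P"
    and k: "1 \<le> k" "k \<le> N"
  defines "Y \<equiv> \<lambda>j. vector_derivative (\<lambda>s. \<phi>1 s (Q j)) (at 0)"
  shows "delta_plus (step a b N) \<alpha> N P (k - 1) \<bullet> Y k = P (k - 1) \<bullet> caputo_minus (step a b N) \<alpha> Y k"
proof -
  let ?h = "step a b N" and ?t = "node a b N k"
  let ?H = "\<lambda>x v w. hamiltonian L f x v w ?t"
  define V where "V = vector_derivative (\<lambda>s. \<phi>2 s (U k)) (at 0)"
  define W where "W = vector_derivative (\<lambda>s. \<phi>3 s (P (k - 1))) (at 0)"
  note zero = groups[THEN one_parameter_group_zero]
  have Y: "((\<lambda>s. \<phi>1 s (Q j)) has_vector_derivative Y j) (at 0)" for j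
    unfolding Y_def using groups(1) by (rule one_parameter_group_has_vector_derivative)
  have V: "((\<lambda>s. \<phi>2 s (U k)) has_vector_derivative V) (at 0)"
    unfolding V_def using groups(2) by (rule one_parameter_group_has_vector_derivative)
  have W: "((\<lambda>s. \<phi>3 s (P (k - 1))) has_vector_derivative W) (at 0)"
    unfolding W_def using groups(3) by (rule one_parameter_group_has_vector_derivative)

  have "real k / real N \<le> 1"
    using k by simp
  then have "real k / real N * (b - a) \<le> 1 * (b - a)"
    using ab by (intro mult_right_mono) auto
  then have "?t \<in> {a..b}"
    using ab by (simp add: node_def step_def)
  from hamiltonian_differentiable[OF L f this]
  obtain H' where H': "((\<lambda>(x, v, w). ?H x v w) has_derivative H') (at (Q k, U k, P (k - 1)))"
    unfolding differentiable_def by blast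
  interpret H': bounded_linear H'
    using H' by (rule has_derivative_bounded_linear)
  have "((\<lambda>s. (\<phi>1 s (Q k), \<phi>2 s (U k), \<phi>3 s (P (k - 1)))) has_derivative
      (\<lambda>u. (u *\<^sub>R Y k, u *\<^sub>R V, u *\<^sub>R W))) (at 0)"
    using Y V W unfolding has_vector_derivative_def by (intro has_derivative_Pair)
  \<comment> \<open>At \<open>s = 0\<close> the groups act as the identity, so the outer derivative
    is taken at the base point of \<open>H'\<close>.\<close>
  from has_derivative_compose[OF this, of "\<lambda>(x, v, w). ?H x v w" H'] H'
  have "((\<lambda>s. ?H (\<phi>1 s (Q k)) (\<phi>2 s (U k)) (\<phi>3 s (P (k - 1)))) has_derivative
      (\<lambda>u. H' (u *\<^sub>R Y k, u *\<^sub>R V, u *\<^sub>R W))) (at 0)"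
    by (simp add: zero)
  moreover have "H' (u *\<^sub>R Y k, u *\<^sub>R V, u *\<^sub>R W) = u *\<^sub>R H' (Y k, V, W)" for u
    by (metis H'.scaleR scaleR_Pair)
  ultimately have 1: "((\<lambda>s. ?H (\<phi>1 s (Q k)) (\<phi>2 s (U k)) (\<phi>3 s (P (k - 1))))
      has_vector_derivative H' (Y k, V, W)) (at 0)"
    by (simp add: has_vector_derivative_def)
  have "((\<lambda>s. \<phi>3 s (P (k - 1)) \<bullet> caputo_minus ?h \<alpha> (\<lambda>j. \<phi>1 s (Q j)) k)
      has_vector_derivative
      P (k - 1) \<bullet> caputo_minus ?h \<alpha> Y k + W \<bullet> caputo_minus ?h \<alpha> Q k) (at 0)"
    using bounded_bilinear.has_vector_derivative[OF bounded_bilinear_inner W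
        caputo_minus_has_vector_derivative[OF Y]]
    by (simp add: zero)
  from has_vector_derivative_diff[OF 1 this]
  \<comment> \<open>Invariance along the given solution replaces the transformed expression by one
    free of \<open>s\<close>; its derivative must then be 0.\<close>
  have "((\<lambda>s. ?H (Q k) (U k) (P (k - 1)) - P (k - 1) \<bullet> caputo_minus ?h \<alpha> Q k)
      has_vector_derivative H' (Y k, V, W)
        - (P (k - 1) \<bullet> caputo_minus ?h \<alpha> Y k + W \<bullet> caputo_minus ?h \<alpha> Q k)) (at 0)"
    using inv sol k unfolding caputo_invariant_def by simp
  then have "H' (Y k, V, W) = P (k - 1) \<bullet> caputo_minus ?h \<alpha> Y k + W \<bullet> caputo_minus ?h \<alpha> Q k"
    using vector_derivative_unique_at[OF _ has_vector_derivative_const] by fastforce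
  moreover have "H' (Y k, V, W) =
      Y k \<bullet> delta_plus ?h \<alpha> N P (k - 1) + V \<bullet> 0 + W \<bullet> caputo_minus ?h \<alpha> Q k"
  proof -
    \<comment> \<open>The adjoint equation is read at index \<open>k - 1\<close>, which places it at
      node \<open>k\<close>; all three gradients then share the base point
      \<open>(Q k, U k, P (k - 1))\<close>.\<close>
    have "delta_plus ?h \<alpha> N P (k - 1) = gradient (\<lambda>x. ?H x (U k) (P (k - 1))) (Q k)"
      using sol k unfolding pontryagin_solution_def by (auto dest!: bspec[of "{0..<N}" _ "k - 1"])
    moreover have "gradient (\<lambda>v. ?H (Q k) v (P (k - 1))) (U k) = 0"
      and "caputo_minus ?h \<alpha> Q k = gradient (\<lambda>w. ?H (Q k) (U k) w) (P (k - 1))"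
      using sol k unfolding pontryagin_solution_def by auto
    ultimately show ?thesis
      using has_derivative_partial_gradients[OF H', of "Y k" V W] by simp
  qed
  ultimately show ?thesis
    by (simp add: inner_commute)
qed

theorem theorem15:
  fixes a b \<alpha> M :: real and N :: nat and A :: "real^'d"
    and L :: "real^'d \<Rightarrow> real^'m \<Rightarrow> real \<Rightarrow> real"
    and f :: "real^'d \<Rightarrow> real^'m \<Rightarrow> real \<Rightarrow> real^'d"
    and \<phi>1 :: "real \<Rightarrow> real^'d \<Rightarrow> real^'d"
    and \<phi>2 :: "real \<Rightarrow> real^'m \<Rightarrow> real^'m"
    and \<phi>3 :: "real \<Rightarrow> real^'d \<Rightarrow> real^'d"
    and Q P :: "nat \<Rightarrow> real^'d" and U :: "nat \<Rightarrow> real^'m"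
  assumes "a < b" and "0 < \<alpha>" and "\<alpha> \<le> 1" and "1 \<le> N"
    and "lagrangian a b L"
    and "constraint_function a b M f"
    and "2 * step a b N powr \<alpha> * M < 1"
    and "one_parameter_group \<phi>1"
    and "one_parameter_group \<phi>2"
    and "one_parameter_group \<phi>3"
    and "caputo_invariant a b N \<alpha> A (hamiltonian L f) \<phi>1 \<phi>2 \<phi>3"
    and "pontryagin_solution a b N \<alpha> A (hamiltonian L f) Q U P"
  shows "\<forall>k\<in>{1..N}.
    delta1_minus (step a b N)
      (\<lambda>i. \<Sum>r=1..N. mat_vec N (matA \<alpha> N r)
         (\<lambda>j. vector_derivative (\<lambda>s. \<phi>1 s (Q j)) (at 0) \<bullet> shift N (r - 1) P j) i) k = 0"
proof
  fix k assume k: "k \<in> {1..N}"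
  define Y where "Y = (\<lambda>j. vector_derivative (\<lambda>s. \<phi>1 s (Q j)) (at 0))"
  let ?h = "step a b N"
  \<comment> \<open>Both discrete derivatives carry this factor; being nonzero, it can be cancelled
    to leave the bare sums produced by the row differences.\<close>
  have h: "?h powr (- \<alpha>) \<noteq> 0"
    using \<open>a < b\<close> \<open>1 \<le> N\<close> by (simp add: step_def)
  have "delta_plus ?h \<alpha> N P (k - 1) \<bullet> Y k = P (k - 1) \<bullet> caputo_minus ?h \<alpha> Y k"
    unfolding Y_def
    by (rule caputo_invariant_derivative[of a b L M f \<phi>1 \<phi>2 \<phi>3 N \<alpha> A Q U]) (use assms k in auto)
  then have "(\<Sum>r=0..N - (k - 1). frac_coeff \<alpha> r *\<^sub>R P (k - 1 + r)) \<bullet> Y k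
      = P (k - 1) \<bullet> (\<Sum>r=0..k. frac_coeff \<alpha> r *\<^sub>R (Y (k - r) - Y 0))"
    using h by (simp add: delta_plus_def caputo_minus_def)
  moreover have "P N = 0"
    using assms(12) by (simp add: pontryagin_solution_def)
  ultimately show "delta1_minus ?h (\<lambda>i. \<Sum>r=1..N. mat_vec N (matA \<alpha> N r)
      (\<lambda>j. vector_derivative (\<lambda>s. \<phi>1 s (Q j)) (at 0) \<bullet> shift N (r - 1) P j) i) k = 0"
    using k sum_mat_vec_matA_diff[of k N P \<alpha> Y] by (simp add: delta1_minus_def Y_def)
qed

end
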